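(* For each $\lambda\in\mathbb{R}^n$, the set $\mathcal{T}_\lambda$ is invariant under each of the flows $S^\lambda_t$ and $\tilde S^\lambda_t$ ($t\ge 0$) and, moreover, on $\mathcal{T}_\lambda$ these two flows are equivalent, i.e. $S^\lambda_t X=\tilde S^\lambda_t X$ for all $X\in\mathcal{T}_\lambda$ and $t\ge 0$.
   Context: Let $n$ be a positive integer and let $\mathcal{T}=\{X=(x^m_i)_{1\le i\le m\le n}:\ x^m_i\in\mathbb{R}\}=\mathbb{R}^{n(n+1)/2}$ be the set of triangles; $m$ is an upper index, not a power. The flow $S^\lambda_t$ on $\mathcal{T}$ is defined, for $\lambda=(\lambda_1,\dots,\lambda_n)\in\mathbb{R}^n$, by $S^\lambda_tX(0)=X(t)$, where $X(t)=(x^m_i(t))$ solves $$\dot x^1_1=\lambda_1;$$ $$\dot x^m_1=\dot x^{m-1}_1+e^{x^m_2-x^{m-1}_1},\qquad \dot x^m_m=\lambda_m-e^{x^m_m-x^{m-1}_{m-1}},\qquad 2\le m\le n;$$ $$\dot x^m_i=\dot x^{m-1}_i+e^{x^m_{i+1}-x^{m-1}_i}-e^{x^m_i-x^{m-1}_{i-1}},\qquad 1<i<m\le n.$$ The flow $\tilde S^\lambda_t$ on $\mathcal{T}$ is defined by $\tilde S^\lambda_tX(0)=X(t)$, where $X(t)$ solves $$\dot x^1_1=\lambda_1;$$ $$\dot x^m_1=\lambda_m+e^{x^{m-1}_1-x^m_1},\qquad \dot x^m_m=\lambda_m-e^{x^m_m-x^{m-1}_{m-1}},\qquad 2\le m\le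 n;$$ $$\dot x^m_i=\lambda_m+e^{x^{m-1}_i-x^m_i}-e^{x^m_i-x^{m-1}_{i-1}},\qquad 1<i<m\le n.$$ For $X\in\mathcal{T}$ define $$l^m_i(X)=e^{x^{m+1}_{i+1}-x^m_i}+e^{x^{m-1}_i-x^m_i}\quad (1\le i<m<n),\qquad l^m_m(X)=e^{x^{m+1}_{m+1}-x^m_m}\quad (1\le m<n),$$ $$r^m_i(X)=e^{x^m_i-x^{m+1}_i}+e^{x^m_i-x^{m-1}_{i-1}}\quad (1<i\le m<n),\qquad r^m_1(X)=e^{x^m_1-x^{m+1}_1}\quad (1\le m<n).$$ The set $\mathcal{T}_\lambda$ consists of those $X\in\mathcal{T}$ satisfying $$\lambda_m+l^m_i(X)=\lambda_{m+1}+r^m_i(X),\qquad 1\le i\le m<n.$$ *)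

theory Defs
  imports Complex_Main
begin

type_synonym triangle = "nat \<Rightarrow> nat \<Rightarrow> real"

text \<open>The entry \<open>x\<^sup>m\<^sub>i\<close> of a triangle \<open>X\<close> is written \<open>X m i\<close>. Only the
  entries with \<open>1 \<le> i \<le> m \<le> n\<close> are data; all others are fixed to \<open>0\<close>, so that triangles of
  size \<open>n\<close> correspond one-to-one to points of \<open>\<real>\<close> to the power \<open>n (n + 1) / 2\<close>. The
  parameter \<open>lam :: nat \<Rightarrow> real\<close> stands for the vector with entries \<open>lam 1, \<dots>, lam n\<close>.\<close>

definition triangles :: "nat \<Rightarrow> triangle set" where
  "triangles n = {X. \<forall>m i. \<not> (1 \<le> i \<and> i \<le> m \<and> m \<le> n) \<longrightarrow> X m i = 0}"

text \<open>A system of differential equations is given as a relation \<open>E X V\<close> between a position \<open>X\<close>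
  and its velocity \<open>V\<close>, where \<open>V m i\<close> is the time derivative of \<open>x\<^sup>m\<^sub>i\<close>.\<close>

definition S_equations :: "nat \<Rightarrow> (nat \<Rightarrow> real) \<Rightarrow> triangle \<Rightarrow> triangle \<Rightarrow> bool" where
  "S_equations n lam X V \<longleftrightarrow>
     V 1 1 = lam 1 \<and>
     (\<forall>m. 2 \<le> m \<and> m \<le> n \<longrightarrow>
        V m 1 = V (m - 1) 1 + exp (X m 2 - X (m - 1) 1) \<and>
        V m m = lam m - exp (X m m - X (m - 1) (m - 1))) \<and>
     (\<forall>m i. 1 < i \<and> i < m \<and> m \<le> n \<longrightarrow>
        V m i = V (m - 1) i + exp (X m (i + 1) - X (m - 1) i) - exp (X m i - X (m - 1) (i - 1)))"

definition S_tilde_equations :: "nat \<Rightarrow> (nat \<Rightarrow> real) \<Rightarrow> triangle \<Rightarrow> triangle \<Rightarrow> bool" where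
  "S_tilde_equations n lam X V \<longleftrightarrow>
     V 1 1 = lam 1 \<and>
     (\<forall>m. 2 \<le> m \<and> m \<le> n \<longrightarrow>
        V m 1 = lam m + exp (X (m - 1) 1 - X m 1) \<and>
        V m m = lam m - exp (X m m - X (m - 1) (m - 1))) \<and>
     (\<forall>m i. 1 < i \<and> i < m \<and> m \<le> n \<longrightarrow>
        V m i = lam m + exp (X (m - 1) i - X m i) - exp (X m i - X (m - 1) (i - 1)))"

text \<open>Solutions live on the time interval \<open>[0, \<infinity>)\<close>; the derivative at \<open>0\<close> is one-sided.\<close>

definition is_solution ::
    "nat \<Rightarrow> (triangle \<Rightarrow> triangle \<Rightarrow> bool) \<Rightarrow> (real \<Rightarrow> triangle) \<Rightarrow> bool" where
  "is_solution n E x \<longleftrightarrow>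
     (\<forall>t\<ge>0. x t \<in> triangles n) \<and>
     (\<exists>v. \<forall>t\<ge>0.
        (\<forall>m i. 1 \<le> i \<and> i \<le> m \<and> m \<le> n \<longrightarrow>
           ((\<lambda>s. x s m i) has_real_derivative v t m i) (at t within {0..})) \<and>
        E (x t) (v t))"

text \<open>The description is meaningful when there is exactly one solution on \<open>[0, \<infinity>)\<close> from \<open>X\<close>.\<close>

definition flow :: "nat \<Rightarrow> (triangle \<Rightarrow> triangle \<Rightarrow> bool) \<Rightarrow> real \<Rightarrow> triangle \<Rightarrow> triangle" where
  "flow n E t X = (THE Y. \<exists>x. is_solution n E x \<and> x 0 = X \<and> Y = x t)"

definition S_flow :: "nat \<Rightarrow> (nat \<Rightarrow> real) \<Rightarrow> real \<Rightarrow> triangle \<Rightarrow> triangle" where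
  "S_flow n lam = flow n (S_equations n lam)"

definition S_tilde_flow :: "nat \<Rightarrow> (nat \<Rightarrow> real) \<Rightarrow> real \<Rightarrow> triangle \<Rightarrow> triangle" where
  "S_tilde_flow n lam = flow n (S_tilde_equations n lam)"

definition l_fun :: "triangle \<Rightarrow> nat \<Rightarrow> nat \<Rightarrow> real" where
  "l_fun X m i =
     (if i < m then exp (X (m + 1) (i + 1) - X m i) + exp (X (m - 1) i - X m i)
      else exp (X (m + 1) (m + 1) - X m m))"

definition r_fun :: "triangle \<Rightarrow> nat \<Rightarrow> nat \<Rightarrow> real" where
  "r_fun X m i =
     (if 1 < i then exp (X m i - X (m + 1) i) + exp (X m i - X (m - 1) (i - 1))
      else exp (X m 1 - X (m + 1) 1))"

definition T_lam :: "nat \<Rightarrow> (nat \<Rightarrow> real) \<Rightarrow> triangle set" where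
  "T_lam n lam = {X \<in> triangles n.
     \<forall>m i. 1 \<le> i \<and> i \<le> m \<and> m < n \<longrightarrow> lam m + l_fun X m i = lam (m + 1) + r_fun X m i}"

end

theory Submission
  imports Defs "HOL-Analysis.Analysis"
begin

text \<open>Put \<open>D\<^sup>m\<^sub>i = \<lambda>\<^sub>m + l\<^sup>m\<^sub>i - \<lambda>\<^sub>m\<^sub>+\<^sub>1 - r\<^sup>m\<^sub>i\<close>, so that \<open>T\<^sub>\<lambda>\<close> is the zero set of all \<open>D\<^sup>m\<^sub>i\<close>. The velocities
  of the two systems at the same point differ by sums of entries \<open>D\<^sup>k\<^sub>i\<close> with \<open>k < m\<close>, hence agree on
  \<open>T\<^sub>\<lambda>\<close>. Take the entries of a triangle in the order of increasing \<open>m\<close> and, within a row, decreasing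
  \<open>i\<close>. Along a solution of the first system, as long as all entries of \<open>D\<close> before \<open>D\<^sup>m\<^sub>i\<close> vanish, the
  derivative of \<open>D\<^sup>m\<^sub>i\<close> is \<open>- exp (x\<^sup>m\<^sup>+\<^sup>1\<^sub>i\<^sub>+\<^sub>1 - x\<^sup>m\<^sub>i) D\<^sup>m\<^sub>i\<close>, so \<open>D\<close> stays zero. The first system
  is solvable on \<open>[0, \<infinity>)\<close> entry by entry, because \<open>u' = f - b exp u\<close> becomes linear in \<open>exp (- u)\<close>;
  a solution starting in \<open>T\<^sub>\<lambda>\<close> then also solves the second system. In both systems the velocity of an
  entry is a decreasing function of that entry when the preceding ones are given, which makes
  solutions unique.\<close>

section \<open>Induction along the order of entries, and a criterion for vanishing\<close>

lemma triangle_induct [consumes 3, case_names entry]: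
  fixes i m n :: nat
  assumes "1 \<le> i" "i \<le> m" "m \<le> n"
    and step: "\<And>m i. 1 \<le> i \<Longrightarrow> i \<le> m \<Longrightarrow> m \<le> n \<Longrightarrow>
      (\<And>k j. 1 \<le> j \<Longrightarrow> j \<le> k \<Longrightarrow> k < m \<or> (k = m \<and> i < j) \<Longrightarrow> P k j) \<Longrightarrow> P m i"
  shows "P m i"
  using assms(1-3)
proof (induction m arbitrary: i rule: less_induct)
  case (less m)
  note row = less.IH
  show ?case
    using less.prems
  proof (induction "m - i" arbitrary: i rule: less_induct)
    case (less i)
    show ?case
    proof (rule step)
      show "P k j" if "1 \<le> j" "j \<le> k" "k < m \<or> (k = m \<and> i < j)" for k j
        using that(3)
      proof (elim disjE conjE)
        assume "k < m"
        then show ?thesis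
          using row that less.prems by simp
      next
        assume "k = m" "i < j"
        then show ?thesis
          using less.hyps[of j] that less.prems by simp
      qed
    qed (use less.prems in auto)
  qed
qed

text \<open>The derivative of \<open>g\<^sup>2\<close> is \<open>2 * g * g'\<close>, so
  \<open>g\<^sup>2\<close> cannot increase from \<open>0\<close>. A sign condition thus replaces a
  Lipschitz bound and a Gronwall estimate.\<close>

lemma eq_0_if_dissipative:
  fixes g g' :: "real \<Rightarrow> real"
  assumes deriv: "\<And>t. t \<ge> 0 \<Longrightarrow> (g has_real_derivative g' t) (at t within {0..})"
    and sign: "\<And>t. t \<ge> 0 \<Longrightarrow> g t * g' t \<le> 0"
    and "g 0 = 0" "t \<ge> 0"
  shows "g t = 0"
proof -
  have "(g t)\<^sup>2 \<le> (g 0)\<^sup>2"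
  proof (rule DERIV_nonpos_imp_decreasing_open[of 0 t "\<lambda>s. (g s)\<^sup>2"])
    show "\<exists>y. ((\<lambda>s. (g s)\<^sup>2) has_real_derivative y) (at s) \<and> y \<le> 0" if "0 < s" "s < t" for s
    proof -
      have "(g has_real_derivative g' s) (at s)"
        using deriv[of s] that at_within_interior[of s "{0::real..}"] by simp
      then have "((\<lambda>s. (g s)\<^sup>2) has_real_derivative 2 * (g s * g' s)) (at s)"
        by (auto intro!: derivative_eq_intros)
      then show ?thesis
        using sign[of s] that by (intro exI[of _ "2 * (g s * g' s)"]) auto
    qed
    have "continuous_on {0..} g"
      using deriv by (intro DERIV_continuous_on) auto
    then show "continuous_on {0..t} (\<lambda>s. (g s)\<^sup>2)"
      by (intro continuous_intros) (rule continuous_on_subset, auto)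
  qed fact
  then show ?thesis
    using \<open>g 0 = 0\<close> by simp
qed

section \<open>Both systems in terms of exponential weights\<close>

text \<open>\<open>up\<close> is \<open>0\<close> at \<open>i = m\<close> and \<open>dn\<close> is
  \<open>0\<close> at \<open>i = 1\<close>: these zeros absorb the boundary cases in both systems
  and in \<open>l_fun\<close> and \<open>r_fun\<close>, leaving uniform formulas.\<close>

definition up :: "triangle \<Rightarrow> nat \<Rightarrow> nat \<Rightarrow> real" where
  "up X m i = (if 1 \<le> i \<and> i < m then exp (X (m - 1) i - X m i) else 0)"

definition dn :: "triangle \<Rightarrow> nat \<Rightarrow> nat \<Rightarrow> real" where
  "dn X m i = (if 1 < i \<and> i \<le> m then exp (X m i - X (m - 1) (i - 1)) else 0)"

definition tilde_vel :: "(nat \<Rightarrow> real) \<Rightarrow> triangle \<Rightarrow> nat \<Rightarrow> nat \<Rightarrow> real" where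
  "tilde_vel lam X m i = lam m + up X m i - dn X m i"

definition defect :: "(nat \<Rightarrow> real) \<Rightarrow> triangle \<Rightarrow> nat \<Rightarrow> nat \<Rightarrow> real" where
  "defect lam X m i = lam m + l_fun X m i - lam (m + 1) - r_fun X m i"

lemma defect_altdef:
  assumes "1 \<le> i" "i \<le> m"
  shows "defect lam X m i =
    lam m - lam (Suc m) + dn X (Suc m) (Suc i) + up X m i - up X (Suc m) i - dn X m i"
  using assms by (auto simp: defect_def l_fun_def r_fun_def up_def dn_def)

lemma T_lam_altdef:
  "T_lam n lam = {X \<in> triangles n. \<forall>m i. 1 \<le> i \<and> i \<le> m \<and> m < n \<longrightarrow> defect lam X m i = 0}"
proof -
  have "defect lam X m i = 0 \<longleftrightarrow> lam m + l_fun X m i = lam (m + 1) + r_fun X m i" for X m i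
    by (auto simp: defect_def)
  then show ?thesis
    by (simp add: T_lam_def)
qed

text \<open>For \<open>1 \<le> i < m\<close> both products are
  \<open>exp (X m (Suc i) - X m i)\<close>; otherwise both are \<open>0\<close>. This cancels the
  quadratic terms in the derivative of the defect.\<close>

lemma dn_mult_up: "dn X (Suc m) (Suc i) * up X (Suc m) (Suc i) = dn X m (Suc i) * up X m i"
  by (auto simp: dn_def up_def simp flip: exp_add)

lemma S_equations_iff:
  assumes "n \<ge> 1"
  shows "S_equations n lam X V \<longleftrightarrow> (\<forall>m i. 1 \<le> i \<and> i \<le> m \<and> m \<le> n \<longrightarrow>
    V m i = (if i < m then V (m - 1) i + dn X m (Suc i) else lam m) - dn X m i)"
    (is "_ \<longleftrightarrow> ?R")
proof
  assume S: "S_equations n lam X V"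
  show ?R
  proof (intro allI impI)
    fix m i assume mi: "1 \<le> i \<and> i \<le> m \<and> m \<le> n"
    consider "m = 1" "i = 1" | "2 \<le> m" "i = 1" | "2 \<le> m" "i = m" | "1 < i" "i < m"
      using mi by linarith
    then show "V m i = (if i < m then V (m - 1) i + dn X m (Suc i) else lam m) - dn X m i"
      using S mi by cases (auto simp: S_equations_def dn_def numeral_2_eq_2)
  qed
next
  assume ?R
  then show "S_equations n lam X V"
    using assms by (auto simp: S_equations_def dn_def numeral_2_eq_2)
qed

lemma S_tilde_equations_iff:
  assumes "n \<ge> 1"
  shows "S_tilde_equations n lam X V \<longleftrightarrow>
    (\<forall>m i. 1 \<le> i \<and> i \<le> m \<and> m \<le> n \<longrightarrow> V m i = tilde_vel lam X m i)"
    (is "_ \<longleftrightarrow> ?R")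
proof
  assume S: "S_tilde_equations n lam X V"
  show ?R
  proof (intro allI impI)
    fix m i assume mi: "1 \<le> i \<and> i \<le> m \<and> m \<le> n"
    consider "m = 1" "i = 1" | "2 \<le> m" "i = 1" | "2 \<le> m" "i = m" | "1 < i" "i < m"
      using mi by linarith
    then show "V m i = tilde_vel lam X m i"
      using S mi by cases (auto simp: S_tilde_equations_def tilde_vel_def dn_def up_def)
  qed
next
  assume ?R
  then show "S_tilde_equations n lam X V"
    using assms by (auto simp: S_tilde_equations_def tilde_vel_def dn_def up_def)
qed

text \<open>On the diagonal entry \<open>(i, i)\<close> both velocities are
  \<open>lam i - dn X i i\<close>. Going down column \<open>i\<close>,
  \<open>defect lam X k i = 0\<close> says exactly that \<open>tilde_vel\<close> satisfies the first
  system's recursion from row \<open>k\<close> to row \<open>Suc k\<close>.\<close>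

lemma S_velocity_eq_tilde_vel:
  assumes S: "S_equations n lam X V" and n: "n \<ge> 1"
    and "1 \<le> i" "i \<le> m" "m \<le> n"
    and "\<And>k. i \<le> k \<Longrightarrow> k < m \<Longrightarrow> defect lam X k i = 0"
  shows "V m i = tilde_vel lam X m i"
  using assms(4-)
proof (induction m rule: dec_induct)
  case base
  then show ?case
    using S \<open>1 \<le> i\<close> by (auto simp: S_equations_iff[OF n] tilde_vel_def up_def)
next
  case (step m)
  have "V (Suc m) i = V m i + dn X (Suc m) (Suc i) - dn X (Suc m) i"
    using S step.hyps step.prems \<open>1 \<le> i\<close> by (auto simp: S_equations_iff[OF n])
  moreover have "V m i = tilde_vel lam X m i"
    using step by auto
  moreover have "defect lam X m i = 0"
    using step by auto
  ultimately show ?case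
    using step.hyps \<open>1 \<le> i\<close> by (auto simp: defect_altdef tilde_vel_def)
qed

section \<open>Uniqueness\<close>

lemma is_solutionE:
  assumes "is_solution n E x"
  obtains v where "\<And>t m i. t \<ge> 0 \<Longrightarrow> 1 \<le> i \<Longrightarrow> i \<le> m \<Longrightarrow> m \<le> n \<Longrightarrow>
      ((\<lambda>s. x s m i) has_real_derivative v t m i) (at t within {0..})"
    and "\<And>t. t \<ge> 0 \<Longrightarrow> E (x t) (v t)" and "\<And>t. t \<ge> 0 \<Longrightarrow> x t \<in> triangles n"
  using assms unfolding is_solution_def by blast

lemma triangles_eqI:
  assumes "X \<in> triangles n" "Y \<in> triangles n"
    and "\<And>m i. 1 \<le> i \<Longrightarrow> i \<le> m \<Longrightarrow> m \<le> n \<Longrightarrow> X m i = Y m i"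
  shows "X = Y"
proof (intro ext)
  fix m i
  show "X m i = Y m i"
    using assms by (cases "1 \<le> i \<and> i \<le> m \<and> m \<le> n") (auto simp: triangles_def)
qed

text \<open>With the neighbouring entry fixed, \<open>dn\<close> increases with the entry itself; it
  enters both velocities with a minus sign, as the vanishing criterion requires.\<close>

lemma dn_dissipative:
  assumes "X (m - 1) (i - 1) = Y (m - 1) (i - 1) \<or> i = 1"
  shows "(X m i - Y m i) * (dn X m i - dn Y m i) \<ge> 0"
proof (cases "X m i \<le> Y m i")
  case True
  then have "dn X m i \<le> dn Y m i"
    using assms by (auto simp: dn_def)
  with True show ?thesis
    by (simp add: mult_nonpos_nonpos)
next
  case False
  then have "dn Y m i \<le> dn X m i"
    using assms by (auto simp: dn_def)
  with False show ?thesis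
    by simp
qed

lemma up_dissipative:
  assumes "X (m - 1) i = Y (m - 1) i \<or> i = m"
  shows "(X m i - Y m i) * (up X m i - up Y m i) \<le> 0"
proof (cases "X m i \<le> Y m i")
  case True
  then have "up Y m i \<le> up X m i"
    using assms by (auto simp: up_def)
  with True show ?thesis
    by (simp add: mult_nonpos_nonneg)
next
  case False
  then have "up X m i \<le> up Y m i"
    using assms by (auto simp: up_def)
  with False show ?thesis
    by (simp add: mult_nonneg_nonpos)
qed

lemma S_solution_unique:
  assumes n: "n \<ge> 1"
    and x: "is_solution n (S_equations n lam) x" and y: "is_solution n (S_equations n lam) y"
    and init: "x 0 = y 0" and t: "t \<ge> 0"
  shows "x t = y t"
proof -
  obtain v where v: "\<And>t m i. t \<ge> 0 \<Longrightarrow> 1 \<le> i \<Longrightarrow> i \<le> m \<Longrightarrow> m \<le> n \<Longrightarrow>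
      ((\<lambda>s. x s m i) has_real_derivative v t m i) (at t within {0..})"
    and Ex: "\<And>t. t \<ge> 0 \<Longrightarrow> S_equations n lam (x t) (v t)"
    and tx: "\<And>t. t \<ge> 0 \<Longrightarrow> x t \<in> triangles n"
    using is_solutionE[OF x] by blast
  obtain w where w: "\<And>t m i. t \<ge> 0 \<Longrightarrow> 1 \<le> i \<Longrightarrow> i \<le> m \<Longrightarrow> m \<le> n \<Longrightarrow>
      ((\<lambda>s. y s m i) has_real_derivative w t m i) (at t within {0..})"
    and Ey: "\<And>t. t \<ge> 0 \<Longrightarrow> S_equations n lam (y t) (w t)"
    and ty: "\<And>t. t \<ge> 0 \<Longrightarrow> y t \<in> triangles n"
    using is_solutionE[OF y] by blast
  \<comment> \<open>Velocities belong to the claim because the first system expresses the velocity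
    of an entry through that of the entry above it.\<close>
  have "\<forall>t\<ge>0. x t m i = y t m i \<and> v t m i = w t m i" if "1 \<le> i" "i \<le> m" "m \<le> n" for m i
    using that
  proof (induction rule: triangle_induct)
    case (entry m i)
    have prev: "x t k j = y t k j" "v t k j = w t k j"
      if "t \<ge> 0" "1 \<le> j" "j \<le> k" "k < m \<or> (k = m \<and> i < j)" for t k j
      using entry.IH that by auto
    have vel: "v t m i - w t m i = - (dn (x t) m i - dn (y t) m i)" if "t \<ge> 0" for t
    proof -
      have "dn (x t) m (Suc i) = dn (y t) m (Suc i)" if "i < m"
        using that \<open>t \<ge> 0\<close> entry.hyps prev[of t "Suc i" m] prev[of t i "m - 1"] by (auto simp: dn_def)
      moreover have "v t (m - 1) i = w t (m - 1) i" if "i < m"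
        using that \<open>t \<ge> 0\<close> entry.hyps prev[of t i "m - 1"] by auto
      ultimately show ?thesis
        using Ex[OF \<open>t \<ge> 0\<close>] Ey[OF \<open>t \<ge> 0\<close>] entry.hyps by (auto simp: S_equations_iff[OF n])
    qed
    have eq: "x t m i = y t m i" if "t \<ge> 0" for t
    proof -
      have "x t m i - y t m i = 0"
      proof (rule eq_0_if_dissipative
          [where g = "\<lambda>t. x t m i - y t m i" and g' = "\<lambda>t. v t m i - w t m i"])
        show "((\<lambda>t. x t m i - y t m i) has_real_derivative v t m i - w t m i) (at t within {0..})"
          if "t \<ge> 0" for t
          using v w that entry.hyps by (intro DERIV_diff) auto
        show "(x t m i - y t m i) * (v t m i - w t m i) \<le> 0" if "t \<ge> 0" for t
        proof -
          have "(x t m i - y t m i) * (dn (x t) m i - dn (y t) m i) \<ge> 0"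
            using prev[of t "i - 1" "m - 1"] that entry.hyps by (intro dn_dissipative) auto
          then show ?thesis
            unfolding vel[OF that] by (simp only: mult_minus_right)
        qed
      qed (use init that in auto)
      then show ?thesis
        by simp
    qed
    moreover have "v t m i = w t m i" if "t \<ge> 0" for t
    proof -
      have "dn (x t) m i = dn (y t) m i"
        using eq[OF that] prev[of t "i - 1" "m - 1"] that entry.hyps by (auto simp: dn_def)
      then show ?thesis
        using vel[OF that] by simp
    qed
    ultimately show ?case
      by blast
  qed
  then show ?thesis
    using t tx ty by (intro triangles_eqI[of _ n]) auto
qed

text \<open>Here the velocity is a function of the position, so the induction carries positions
  only; both weights contribute with the dissipative sign.\<close>

lemma S_tilde_solution_unique:
  assumes n: "n \<ge> 1"
    and x: "is_solution n (S_tilde_equations n lam) x"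
    and y: "is_solution n (S_tilde_equations n lam) y"
    and init: "x 0 = y 0" and t: "t \<ge> 0"
  shows "x t = y t"
proof -
  obtain v where v: "\<And>t m i. t \<ge> 0 \<Longrightarrow> 1 \<le> i \<Longrightarrow> i \<le> m \<Longrightarrow> m \<le> n \<Longrightarrow>
      ((\<lambda>s. x s m i) has_real_derivative v t m i) (at t within {0..})"
    and Ex: "\<And>t. t \<ge> 0 \<Longrightarrow> S_tilde_equations n lam (x t) (v t)"
    and tx: "\<And>t. t \<ge> 0 \<Longrightarrow> x t \<in> triangles n"
    using is_solutionE[OF x] by blast
  obtain w where w: "\<And>t m i. t \<ge> 0 \<Longrightarrow> 1 \<le> i \<Longrightarrow> i \<le> m \<Longrightarrow> m \<le> n \<Longrightarrow>
      ((\<lambda>s. y s m i) has_real_derivative w t m i) (at t within {0..})"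
    and Ey: "\<And>t. t \<ge> 0 \<Longrightarrow> S_tilde_equations n lam (y t) (w t)"
    and ty: "\<And>t. t \<ge> 0 \<Longrightarrow> y t \<in> triangles n"
    using is_solutionE[OF y] by blast
  have "\<forall>t\<ge>0. x t m i = y t m i" if "1 \<le> i" "i \<le> m" "m \<le> n" for m i
    using that
  proof (induction rule: triangle_induct)
    case (entry m i)
    have "x t m i - y t m i = 0" if "t \<ge> 0" for t
    proof (rule eq_0_if_dissipative
          [where g = "\<lambda>t. x t m i - y t m i" and g' = "\<lambda>t. v t m i - w t m i"])
      show "((\<lambda>t. x t m i - y t m i) has_real_derivative v t m i - w t m i) (at t within {0..})"
        if "t \<ge> 0" for t
        using v w that entry.hyps by (intro DERIV_diff) auto
      show "(x t m i - y t m i) * (v t m i - w t m i) \<le> 0" if "t \<ge> 0" for t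
      proof -
        have "v t m i - w t m i = (up (x t) m i - up (y t) m i) - (dn (x t) m i - dn (y t) m i)"
          using Ex[OF that] Ey[OF that] entry.hyps
          by (auto simp: S_tilde_equations_iff[OF n] tilde_vel_def)
        moreover have "(x t m i - y t m i) * (dn (x t) m i - dn (y t) m i) \<ge> 0"
          using entry.IH[of "i - 1" "m - 1"] that entry.hyps by (intro dn_dissipative) auto
        moreover have "(x t m i - y t m i) * (up (x t) m i - up (y t) m i) \<le> 0"
          using entry.IH[of i "m - 1"] that entry.hyps by (intro up_dissipative) auto
        ultimately show ?thesis
          by (simp only: right_diff_distrib)
      qed
    qed (use init that in auto)
    then show ?case
      by simp
  qed
  then show ?thesis
    using t tx ty by (intro triangles_eqI[of _ n]) auto
qed

lemma flow_eq:
  assumes "is_solution n E x" "x 0 = X"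
    and "\<And>y. is_solution n E y \<Longrightarrow> y 0 = X \<Longrightarrow> y t = x t"
  shows "flow n E t X = x t"
  unfolding flow_def
proof (rule the_equality)
  show "\<exists>y. is_solution n E y \<and> y 0 = X \<and> x t = y t"
    using assms(1,2) by blast
  show "Y = x t" if "\<exists>y. is_solution n E y \<and> y 0 = X \<and> Y = y t" for Y
    using that assms(3) by blast
qed

section \<open>Existence\<close>

lemma has_real_derivative_integral_atLeast:
  fixes f :: "real \<Rightarrow> real"
  assumes "continuous_on {0..} f" "t \<ge> 0"
  shows "((\<lambda>t. integral {0..t} f) has_real_derivative f t) (at t within {0..})"
proof -
  \<comment> \<open>The interval extends beyond \<open>t\<close>, so that it agrees with
    \<open>{0..}\<close> near \<open>t\<close>.\<close>
  have "((\<lambda>t. integral {0..t} f) has_real_derivative f t) (at t within {0..t + 1})"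
    using assms by (intro integral_has_real_derivative continuous_on_subset[OF assms(1)]) auto
  moreover have "at t within {0..t + 1} = at t within {0..}"
    by (rule at_within_nhd[of _ "{t - 1<..<t + 1}"]) auto
  ultimately show ?thesis
    by simp
qed

text \<open>The solution of \<open>u' = f - b exp u\<close>, \<open>u 0 = c\<close>: with \<open>F\<close> the integral of \<open>f\<close>, the function
  \<open>exp (F - u)\<close> has derivative \<open>b exp F\<close>.\<close>

definition relax :: "(real \<Rightarrow> real) \<Rightarrow> (real \<Rightarrow> real) \<Rightarrow> real \<Rightarrow> real \<Rightarrow> real" where
  "relax f b c t = integral {0..t} f -
     ln (exp (- c) + integral {0..t} (\<lambda>s. b s * exp (integral {0..s} f)))"

lemma relax_0: "relax f b c 0 = c"
  by (simp add: relax_def)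

text \<open>Since \<open>b \<ge> 0\<close>, the argument of the logarithm stays at least
  \<open>exp (- c)\<close>. Hence there is no blow-up in forward time.\<close>

lemma has_real_derivative_relax:
  assumes f: "continuous_on {0..} f" and b: "continuous_on {0..} b"
    and b0: "\<And>t. t \<ge> 0 \<Longrightarrow> b t \<ge> 0" and t: "t \<ge> 0"
  shows "(relax f b c has_real_derivative f t - b t * exp (relax f b c t)) (at t within {0..})"
proof -
  define F where "F t = integral {0..t} f" for t
  define G where "G t = exp (- c) + integral {0..t} (\<lambda>s. b s * exp (F s))" for t
  have relax: "relax f b c = (\<lambda>t. F t - ln (G t))"
    by (simp add: relax_def F_def G_def fun_eq_iff)
  have F: "(F has_real_derivative f t) (at t within {0..})" if "t \<ge> 0" for t
    unfolding F_def using has_real_derivative_integral_atLeast[OF f that] .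
  then have "continuous_on {0..} F"
    by (intro DERIV_continuous_on) auto
  then have cont: "continuous_on {0..} (\<lambda>s. b s * exp (F s))"
    using b by (intro continuous_intros)
  from has_real_derivative_integral_atLeast[OF this t]
  have G: "(G has_real_derivative b t * exp (F t)) (at t within {0..})"
    unfolding G_def by (auto intro!: derivative_eq_intros)
  have pos: "G t > 0"
  proof -
    have "continuous_on {0..t} (\<lambda>s. b s * exp (F s))"
      by (rule continuous_on_subset[OF cont]) simp
    then have "integral {0..t} (\<lambda>s. b s * exp (F s)) \<ge> 0"
      using b0 by (intro integral_nonneg integrable_continuous_real) auto
    then show ?thesis
      unfolding G_def by (intro add_pos_nonneg) auto
  qed
  have "((\<lambda>t. F t - ln (G t)) has_real_derivative f t - b t * exp (F t) / G t) (at t within {0..})"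
    using F[OF t] G pos by (auto intro!: derivative_eq_intros simp: field_simps)
  then show ?thesis
    unfolding relax using pos by (simp add: exp_diff)
qed

text \<open>The component \<open>S_path lam X m i\<close> consists of position and velocity of the entry \<open>(m, i)\<close> along
  the solution of the first system that starts at \<open>X\<close>.\<close>

function S_path :: "(nat \<Rightarrow> real) \<Rightarrow> triangle \<Rightarrow> nat \<Rightarrow> nat \<Rightarrow> (real \<Rightarrow> real) \<times> (real \<Rightarrow> real)" where
  "S_path lam X m i =
     (let f = if i < m
          then (\<lambda>t. snd (S_path lam X (m - 1) i) t +
                 exp (fst (S_path lam X m (Suc i)) t - fst (S_path lam X (m - 1) i) t))
          else (\<lambda>t. lam m);
        b = if 1 < i \<and> i \<le> m then (\<lambda>t. exp (- fst (S_path lam X (m - 1) (i - 1)) t)) else (\<lambda>t. 0);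
        u = relax f b (X m i)
      in (u, \<lambda>t. f t - b t * exp (u t)))"
  by auto
text \<open>The guards \<open>i < m\<close> and \<open>1 < i \<and> i \<le> m\<close> force
  \<open>m > 0\<close>, so the calls in row \<open>m - 1\<close> decrease \<open>m\<close>; the call
  at \<open>Suc i\<close> decreases \<open>m - i\<close>.\<close>

termination
  by (relation "measures [\<lambda>(lam, X, m, i). m, \<lambda>(lam, X, m, i). m - i]") auto

declare S_path.simps [simp del]

text \<open>Continuity of the velocity is carried along because it is part of the forcing term
  \<open>f\<close> of the entry below, which must be continuous to be integrated.\<close>

lemma S_path_properties:
  fixes lam X
  defines "p \<equiv> \<lambda>m i. fst (S_path lam X m i)" and "v \<equiv> \<lambda>m i. snd (S_path lam X m i)"
  assumes "1 \<le> i" "i \<le> m" "m \<le> n"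
  shows "p m i 0 = X m i \<and> continuous_on {0..} (v m i) \<and>
    (\<forall>t\<ge>0. (p m i has_real_derivative v m i t) (at t within {0..}) \<and>
      v m i t = (if i < m then v (m - 1) i t + exp (p m (Suc i) t - p (m - 1) i t) else lam m) -
        (if 1 < i then exp (p m i t - p (m - 1) (i - 1) t) else 0))"
  using assms(3-)
proof (induction rule: triangle_induct)
  case (entry m i)
  define f where "f = (if i < m then (\<lambda>t. v (m - 1) i t + exp (p m (Suc i) t - p (m - 1) i t))
    else (\<lambda>t. lam m))"
  define b where "b = (if 1 < i \<and> i \<le> m then (\<lambda>t. exp (- p (m - 1) (i - 1) t)) else (\<lambda>t. 0))"
  have p: "p m i = relax f b (X m i)"
    unfolding p_def v_def f_def b_def by (subst S_path.simps) (simp add: Let_def)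
  have v: "v m i = (\<lambda>t. f t - b t * exp (p m i t))"
    unfolding p unfolding p_def v_def f_def b_def by (subst S_path.simps) (simp add: Let_def)
  have prev: "continuous_on {0..} (p k j)" "continuous_on {0..} (v k j)"
    if "1 \<le> j" "j \<le> k" "k < m \<or> (k = m \<and> i < j)" for k j
    using entry.IH[OF that] by (auto intro!: DERIV_continuous_on)
  have f: "continuous_on {0..} f"
    using entry.hyps unfolding f_def by (auto intro!: continuous_intros prev)
  have b: "continuous_on {0..} b"
    using entry.hyps unfolding b_def by (auto intro!: continuous_intros prev)
  have deriv: "(p m i has_real_derivative v m i t) (at t within {0..})" if "t \<ge> 0" for t
    unfolding p v by (rule has_real_derivative_relax[OF f b _ that]) (auto simp: b_def)
  have "continuous_on {0..} (p m i)"
    using deriv by (intro DERIV_continuous_on) auto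
  then have "continuous_on {0..} (v m i)"
    unfolding v by (intro continuous_intros f b)
  moreover have "v m i t =
        (if i < m then v (m - 1) i t + exp (p m (Suc i) t - p (m - 1) i t) else lam m) -
        (if 1 < i then exp (p m i t - p (m - 1) (i - 1) t) else 0)" for t
    using entry.hyps by (simp add: v f_def b_def exp_diff exp_minus field_simps)
  ultimately show ?case
    using deriv p relax_0 by auto
qed

lemma S_solution_exists:
  assumes n: "n \<ge> 1" and X: "X \<in> triangles n"
  obtains x where "is_solution n (S_equations n lam) x" "x 0 = X"
proof -
  define x where
    "x t m i = (if 1 \<le> i \<and> i \<le> m \<and> m \<le> n then fst (S_path lam X m i) t else 0)" for t m i
  define v where "v t m i = snd (S_path lam X m i) t" for t m i
  have "S_equations n lam (x t) (v t)" if "t \<ge> 0" for t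
    unfolding S_equations_iff[OF n]
  proof (intro allI impI)
    fix m i assume mi: "1 \<le> i \<and> i \<le> m \<and> m \<le> n"
    then show "v t m i =
        (if i < m then v t (m - 1) i + dn (x t) m (Suc i) else lam m) - dn (x t) m i"
      using S_path_properties[of i m n lam X] that by (auto simp: v_def x_def dn_def)
  qed
  moreover have "((\<lambda>s. x s m i) has_real_derivative v t m i) (at t within {0..})"
    if "t \<ge> 0" "1 \<le> i" "i \<le> m" "m \<le> n" for t m i
  proof -
    have "(fst (S_path lam X m i) has_real_derivative snd (S_path lam X m i) t) (at t within {0..})"
      using S_path_properties[of i m n lam X] that by blast
    then show ?thesis
      using that by (simp add: x_def v_def)
  qed
  moreover have "x t \<in> triangles n" for t
    by (auto simp: triangles_def x_def)
  ultimately have "is_solution n (S_equations n lam) x"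
    unfolding is_solution_def by blast
  moreover have "fst (S_path lam X m i) 0 = X m i" if "1 \<le> i" "i \<le> m" "m \<le> n" for m i
    using S_path_properties[OF that] by blast
  then have "x 0 = X"
    using X by (auto simp: triangles_def x_def fun_eq_iff)
  ultimately show thesis
    by (rule that)
qed

section \<open>Invariance\<close>

text \<open>Outside the index range the weight is identically \<open>0\<close>, and the factor
  \<open>dn (x t) m i\<close> removes whatever \<open>V\<close> is there.\<close>

lemma has_real_derivative_dn:
  assumes "\<And>m i. 1 \<le> i \<Longrightarrow> i \<le> m \<Longrightarrow> m \<le> n \<Longrightarrow>
      ((\<lambda>s. x s m i) has_real_derivative V m i) (at t within A)"
    and "m \<le> n"
  shows "((\<lambda>s. dn (x s) m i) has_real_derivative dn (x t) m i * (V m i - V (m - 1) (i - 1)))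
    (at t within A)"
proof (cases "1 < i \<and> i \<le> m")
  case True
  then have "((\<lambda>s. exp (x s m i - x s (m - 1) (i - 1))) has_real_derivative
      exp (x t m i - x t (m - 1) (i - 1)) * (V m i - V (m - 1) (i - 1))) (at t within A)"
    using assms by (intro DERIV_chain2[OF DERIV_exp] DERIV_diff) auto
  then show ?thesis
    using True by (simp add: dn_def)
next
  case False
  then have "dn (x s) m i = 0" for s
    unfolding dn_def by (rule if_not_P)
  then show ?thesis
    by simp
qed

lemma has_real_derivative_up:
  assumes "\<And>m i. 1 \<le> i \<Longrightarrow> i \<le> m \<Longrightarrow> m \<le> n \<Longrightarrow>
      ((\<lambda>s. x s m i) has_real_derivative V m i) (at t within A)"
    and "m \<le> n"
  shows "((\<lambda>s. up (x s) m i) has_real_derivative up (x t) m i * (V (m - 1) i - V m i))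
    (at t within A)"
proof (cases "1 \<le> i \<and> i < m")
  case True
  then have "((\<lambda>s. exp (x s (m - 1) i - x s m i)) has_real_derivative
      exp (x t (m - 1) i - x t m i) * (V (m - 1) i - V m i)) (at t within A)"
    using assms by (intro DERIV_chain2[OF DERIV_exp] DERIV_diff) auto
  then show ?thesis
    using True by (simp add: up_def)
next
  case False
  then have "up (x s) m i = 0" for s
    unfolding up_def by (rule if_not_P)
  then show ?thesis
    by simp
qed

text \<open>The left side is the derivative of \<open>defect lam X m i\<close> by the chain rule.
  After velocity differences are rewritten as differences of weights, all products cancel in pairs
  except the one with the defect.\<close>

lemma defect_velocity:
  assumes S: "S_equations n lam X V" and n: "n \<ge> 1" and mi: "1 \<le> i" "i \<le> m" "m < n"
    and prev: "\<And>k j. 1 \<le> j \<Longrightarrow> j \<le> k \<Longrightarrow> k < m \<or> (k = m \<and> i < j) \<Longrightarrow> defect lam X k j = 0"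
  shows "dn X (Suc m) (Suc i) * (V (Suc m) (Suc i) - V m i) + up X m i * (V (m - 1) i - V m i)
    - up X (Suc m) i * (V m i - V (Suc m) i) - dn X m i * (V m i - V (m - 1) (i - 1))
    = - dn X (Suc m) (Suc i) * defect lam X m i"
proof -
  let ?W = "tilde_vel lam X" and ?D = "defect lam X m i"
  have V: "V k j = ?W k j" if "1 \<le> j" "j \<le> k" "k \<le> m" for k j
    using that mi prev by (intro S_velocity_eq_tilde_vel[OF S n]) auto
  \<comment> \<open>Only defects in column \<open>Suc i\<close> up to row \<open>m\<close> are
    involved, and these all precede \<open>(m, i)\<close>.\<close>
  have V1: "V (Suc m) (Suc i) = ?W (Suc m) (Suc i)"
    using mi by (intro S_velocity_eq_tilde_vel[OF S n] prev) auto
  \<comment> \<open>Comparison with \<open>?W\<close> would involve the defect at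
    \<open>(m, i)\<close> itself, not known to vanish; the recursion is used instead.\<close>
  have V2: "V (Suc m) i = V m i + dn X (Suc m) (Suc i) - dn X (Suc m) i"
    using S mi by (auto simp: S_equations_iff[OF n])
  have D: "?D = lam m - lam (Suc m) + dn X (Suc m) (Suc i) + up X m i - up X (Suc m) i - dn X m i"
    using defect_altdef[OF mi(1,2)] .
  have a: "V (Suc m) (Suc i) - V m i = up X (Suc m) (Suc i) - up X (Suc m) i - ?D"
    using V1 V[of i m] mi D by (simp add: tilde_vel_def)
  have b: "V m i - V (Suc m) i = dn X (Suc m) i - dn X (Suc m) (Suc i)"
    using V2 by simp
  have c: "up X m i * (V (m - 1) i - V m i) = up X m i * (dn X m i - dn X m (Suc i))"
  proof (cases "i < m")
    case True
    then have "V m i = V (m - 1) i + dn X m (Suc i) - dn X m i"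
      using S mi by (auto simp: S_equations_iff[OF n])
    then show ?thesis
      by simp
  qed (simp add: up_def)
  \<comment> \<open>As in \<open>a\<close>, with \<open>(m - 1, i - 1)\<close> for
    \<open>(m, i)\<close>; there the defect is already \<open>0\<close>.\<close>
  have d: "dn X m i * (V m i - V (m - 1) (i - 1)) = dn X m i * (up X m i - up X m (i - 1))"
  proof (cases "1 < i")
    case True
    then have "defect lam X (m - 1) (i - 1) = 0"
      using mi by (intro prev) auto
    moreover have "defect lam X (m - 1) (i - 1) = lam (m - 1) - lam m + dn X m i
        + up X (m - 1) (i - 1) - up X m (i - 1) - dn X (m - 1) (i - 1)"
      using mi True defect_altdef[of "i - 1" "m - 1" lam X] by simp
    ultimately show ?thesis
      using V[of i m] V[of "i - 1" "m - 1"] mi True by (simp add: tilde_vel_def diff_le_mono)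
  qed (simp add: dn_def)
  have e: "dn X (Suc m) (Suc i) * up X (Suc m) (Suc i) = dn X m (Suc i) * up X m i"
    by (rule dn_mult_up)
  have g: "dn X (Suc m) i * up X (Suc m) i = dn X m i * up X m (i - 1)"
    using dn_mult_up[of X m "i - 1"] mi by simp
  show ?thesis
    unfolding a b c d using e g by (simp add: algebra_simps)
qed

lemma S_solution_in_T_lam:
  assumes n: "n \<ge> 1" and x: "is_solution n (S_equations n lam) x"
    and init: "x 0 \<in> T_lam n lam" and t: "t \<ge> 0"
  shows "x t \<in> T_lam n lam"
proof -
  obtain v where v: "\<And>t m i. t \<ge> 0 \<Longrightarrow> 1 \<le> i \<Longrightarrow> i \<le> m \<Longrightarrow> m \<le> n \<Longrightarrow>
      ((\<lambda>s. x s m i) has_real_derivative v t m i) (at t within {0..})"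
    and E: "\<And>t. t \<ge> 0 \<Longrightarrow> S_equations n lam (x t) (v t)"
    and tx: "\<And>t. t \<ge> 0 \<Longrightarrow> x t \<in> triangles n"
    using is_solutionE[OF x] by blast
  \<comment> \<open>The induction runs over a triangle of size \<open>n - 1\<close>, since a defect
    in row \<open>m\<close> involves row \<open>Suc m\<close>.\<close>
  have "\<forall>t\<ge>0. defect lam (x t) m i = 0" if "1 \<le> i" "i \<le> m" "m \<le> n - 1" for m i
    using that
  proof (induction rule: triangle_induct)
    case (entry m i)
    have m: "m < n"
      using entry.hyps n by simp
    let ?g' = "\<lambda>t. - dn (x t) (Suc m) (Suc i) * defect lam (x t) m i"
    have "defect lam (x t) m i = 0" if "t \<ge> 0" for t
    proof (rule eq_0_if_dissipative[where g = "\<lambda>t. defect lam (x t) m i" and g' = ?g'])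
      show "((\<lambda>t. defect lam (x t) m i) has_real_derivative ?g' t) (at t within {0..})"
        if t: "t \<ge> 0" for t
      proof -
        have dn: "((\<lambda>s. dn (x s) k j) has_real_derivative
              dn (x t) k j * (v t k j - v t (k - 1) (j - 1))) (at t within {0..})"
          and up: "((\<lambda>s. up (x s) k j) has_real_derivative
              up (x t) k j * (v t (k - 1) j - v t k j)) (at t within {0..})"
          if "k \<le> n" for k j
          by (rule has_real_derivative_dn[where V = "v t", OF v[OF t] that]
              has_real_derivative_up[where V = "v t", OF v[OF t] that]; assumption)+
        have vel: "dn (x t) (Suc m) (Suc i) * (v t (Suc m) (Suc i) - v t m i)
            + up (x t) m i * (v t (m - 1) i - v t m i)
            - up (x t) (Suc m) i * (v t m i - v t (Suc m) i)
            - dn (x t) m i * (v t m i - v t (m - 1) (i - 1)) = ?g' t"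
          using entry.IH t by (intro defect_velocity[OF E[OF t] n entry.hyps(1,2) m]) auto
        have "((\<lambda>s. lam m - lam (Suc m) + dn (x s) (Suc m) (Suc i) + up (x s) m i
            - up (x s) (Suc m) i - dn (x s) m i) has_real_derivative ?g' t) (at t within {0..})"
          unfolding vel[symmetric]
          using m dn[of "Suc m" "Suc i"] up[of m i] up[of "Suc m" i] dn[of m i]
          by (auto intro!: derivative_eq_intros)
        then show ?thesis
          using entry.hyps by (simp add: defect_altdef)
      qed
      show "defect lam (x t) m i * ?g' t \<le> 0" for t
      proof -
        have "dn (x t) (Suc m) (Suc i) * (defect lam (x t) m i)\<^sup>2 \<ge> 0"
          by (simp add: dn_def)
        then show ?thesis
          by (simp only: power2_eq_square mult_minus_left mult_minus_right neg_le_0_iff_le ac_simps)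
      qed
      show "defect lam (x 0) m i = 0"
        using init entry.hyps m by (auto simp: T_lam_altdef)
    qed fact
    then show ?case
      by blast
  qed
  then show ?thesis
    using t tx by (auto simp: T_lam_altdef)
qed

text \<open>The two systems agree pointwise on \<open>T_lam\<close>. This also supplies existence
  for the second system from starting points in \<open>T_lam\<close>.\<close>

lemma S_solution_imp_S_tilde_solution:
  assumes n: "n \<ge> 1" and x: "is_solution n (S_equations n lam) x"
    and T: "\<And>t. t \<ge> 0 \<Longrightarrow> x t \<in> T_lam n lam"
  shows "is_solution n (S_tilde_equations n lam) x"
proof -
  have "S_tilde_equations n lam X V" if "S_equations n lam X V" "X \<in> T_lam n lam" for X V
    unfolding S_tilde_equations_iff[OF n]
    using that by (auto simp: T_lam_altdef intro!: S_velocity_eq_tilde_vel[OF _ n])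
  then show ?thesis
    using x T unfolding is_solution_def by blast
qed

theorem proposition8p1:
  fixes n :: nat and lam :: "nat \<Rightarrow> real"
  assumes "n \<ge> 1"
  shows "(\<forall>X\<in>T_lam n lam. \<forall>t\<ge>0. S_flow n lam t X \<in> T_lam n lam) \<and>
    (\<forall>X\<in>T_lam n lam. \<forall>t\<ge>0. S_tilde_flow n lam t X \<in> T_lam n lam) \<and>
    (\<forall>X\<in>T_lam n lam. \<forall>t\<ge>0. S_flow n lam t X = S_tilde_flow n lam t X)"
proof -
  have "S_flow n lam t X \<in> T_lam n lam \<and> S_flow n lam t X = S_tilde_flow n lam t X"
    if X: "X \<in> T_lam n lam" and t: "t \<ge> 0" for X t
  proof -
    have "X \<in> triangles n"
      using X by (simp add: T_lam_def)
    then obtain x where x: "is_solution n (S_equations n lam) x" "x 0 = X"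
      using S_solution_exists[OF assms] by blast
    have T: "x s \<in> T_lam n lam" if "s \<ge> 0" for s
      using S_solution_in_T_lam[OF assms x(1) _ that] X x(2) by simp
    have x': "is_solution n (S_tilde_equations n lam) x"
      using S_solution_imp_S_tilde_solution[OF assms x(1) T] .
    have "S_flow n lam t X = x t"
      unfolding S_flow_def
      by (rule flow_eq[OF x]) (use x(2) in \<open>auto intro: S_solution_unique[OF assms _ x(1) _ t]\<close>)
    moreover have "S_tilde_flow n lam t X = x t"
      unfolding S_tilde_flow_def
      by (rule flow_eq[OF x' x(2)])
        (use x(2) in \<open>auto intro: S_tilde_solution_unique[OF assms _ x' _ t]\<close>)
    ultimately show ?thesis
      using T[OF t] by simp
  qed
  then show ?thesis
    by metis
qed

end
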